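(* Let $A\in\mathbb{R}_+^{n\times n}$ have nonzero max-algebraic permanent. For any permutation $\sigma$ of $\{1,\dots,n\}$ with maximal weight, $$A^{c\sigma *}=D^{\sigma} A^{\bigtriangledown}=A\otimes A^{\bigtriangledown}\qquad\text{and}\qquad A^{r\sigma *}=A^{\bigtriangledown} D^{\sigma}=A^{\bigtriangledown}\otimes A .$$
   Context: Max algebra on $\mathbb{R}_+$ (nonnegative reals): $a\oplus b=\max(a,b)$, $a\otimes b=ab$; matrix product $(A\otimes B)_{ij}=\max_k a_{ik}b_{kj}$. For $A=(a_{ij})\in\mathbb{R}_+^{n\times n}$ the weight of a permutation $\sigma$ is $w(\sigma)=\prod_{i=1}^n a_{i\sigma(i)}$, and the max-algebraic permanent is $\operatorname{per}(A)=\max_{\sigma}w(\sigma)$ over all permutations of $\{1,\dots,n\}$ (the permanent of the empty matrix is $1$); $\sigma$ has maximal weight if $w(\sigma)=\operatorname{per}(A)$. The pseudoadjugate $A^{\operatorname{adj}}$ has entries $a^{\operatorname{adj}}_{ij}=\operatorname{per}(A_{ji})$, where $A_{ji}$ is obtained from $A$ by deleting row $j$ and column $i$. The pseudoinverse is $A^{\bigtriangledown}=(\operatorname{per}(A))^{-1}A^{\operatorname{adj}}$. $D^\sigma=(d^\sigma_{ij})$ is the monomial matrix with $d^\sigma_{ij}=a_{ij}$ if $j=\sigma(i)$ and $0$ otherwise. Define $A^{c\sigma}=A(D^\sigma)^{-1}$ and $A^{r\sigma}=(D^\sigma)^{-1}A$, i.e. $a^{c\sigma}_{ij}=a_{i\sigma(j)}a_{j\sigma(j)}^{-1}$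 and $a^{r\sigma}_{ij}=a_{\sigma^{-1}(i)i}^{-1}a_{\sigma^{-1}(i)j}$. The Kleene star of a square matrix $B$ is $B^*=I\oplus B\oplus B^2\oplus\cdots$ (max-algebraic powers, $I$ the unit matrix); $A^{c\sigma *}$ and $A^{r\sigma *}$ denote the Kleene stars of $A^{c\sigma}$ and $A^{r\sigma}$, respectively (they are finite for $\sigma$ of maximal weight). *)

theory Defs
  imports
    "Jordan_Normal_Form.Determinant"
    "HOL-Library.Extended_Nonnegative_Real"
begin

text \<open>
  Square matrices over the max algebra are real matrices with nonnegative entries; rows and columns
  are numbered from 0, and permutations act on \<open>{0..<n}\<close>. The additive structure of the type of
  reals is not the one of the max algebra, so the product and the powers below are not those of
  the matrix library; the unit matrix and the scalar multiples are.
\<close>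

definition nonneg_mat :: "nat \<Rightarrow> real mat \<Rightarrow> bool" where
  "nonneg_mat n A \<longleftrightarrow> A \<in> carrier_mat n n \<and> (\<forall>i<n. \<forall>j<n. 0 \<le> A $$ (i, j))"

definition max_mult :: "real mat \<Rightarrow> real mat \<Rightarrow> real mat"  (infixl \<open>\<otimes>\<^sub>m\<^sub>a\<^sub>x\<close> 70) where
  "A \<otimes>\<^sub>m\<^sub>a\<^sub>x B = mat (dim_row A) (dim_col B)
     (\<lambda>(i, j). Max {A $$ (i, k) * B $$ (k, j) | k. k < dim_col A})"

fun max_pow :: "real mat \<Rightarrow> nat \<Rightarrow> real mat" where
  "max_pow B 0 = 1\<^sub>m (dim_row B)"
| "max_pow B (Suc k) = max_pow B k \<otimes>\<^sub>m\<^sub>a\<^sub>x B"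

definition perm_weight :: "real mat \<Rightarrow> (nat \<Rightarrow> nat) \<Rightarrow> real" where
  "perm_weight A \<sigma> = (\<Prod>i = 0..<dim_row A. A $$ (i, \<sigma> i))"

text \<open>For the empty matrix the only permutation is the identity, with weight 1.\<close>

definition max_per :: "real mat \<Rightarrow> real" where
  "max_per A = Max {perm_weight A \<sigma> | \<sigma>. \<sigma> permutes {0..<dim_row A}}"

definition pseudoadj :: "real mat \<Rightarrow> real mat" where
  "pseudoadj A = mat (dim_row A) (dim_row A) (\<lambda>(i, j). max_per (mat_delete A j i))"

definition pseudoinv :: "real mat \<Rightarrow> real mat" where
  "pseudoinv A = inverse (max_per A) \<cdot>\<^sub>m pseudoadj A"

definition monomial_part :: "real mat \<Rightarrow> (nat \<Rightarrow> nat) \<Rightarrow> real mat" where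
  "monomial_part A \<sigma> = mat (dim_row A) (dim_row A)
     (\<lambda>(i, j). if j = \<sigma> i then A $$ (i, j) else 0)"

text \<open>
  The inverse of \<^term>\<open>monomial_part A \<sigma>\<close> when \<open>\<sigma>\<close> has nonzero weight; see
  \<open>monomial_part_inverse\<close> below.
\<close>

definition monomial_part_inv :: "real mat \<Rightarrow> (nat \<Rightarrow> nat) \<Rightarrow> real mat" where
  "monomial_part_inv A \<sigma> = mat (dim_row A) (dim_row A)
     (\<lambda>(i, j). if i = \<sigma> j then inverse (A $$ (j, i)) else 0)"

definition col_normal :: "real mat \<Rightarrow> (nat \<Rightarrow> nat) \<Rightarrow> real mat" where
  "col_normal A \<sigma> = A \<otimes>\<^sub>m\<^sub>a\<^sub>x monomial_part_inv A \<sigma>"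

definition row_normal :: "real mat \<Rightarrow> (nat \<Rightarrow> nat) \<Rightarrow> real mat" where
  "row_normal A \<sigma> = monomial_part_inv A \<sigma> \<otimes>\<^sub>m\<^sub>a\<^sub>x A"

text \<open>
  The supremum of the powers is taken in \<open>[0, \<infinity>]\<close>, so a divergent star has infinite entries, and
  an equation between a star and the image of a real matrix includes the finiteness of the star.
\<close>

definition ennmat :: "real mat \<Rightarrow> ennreal mat" where
  "ennmat A = map_mat ennreal A"

definition kleene_star :: "real mat \<Rightarrow> ennreal mat" where
  "kleene_star B = mat (dim_row B) (dim_row B) (\<lambda>(i, j). SUP k. ennreal (max_pow B k $$ (i, j)))"

lemma Max_single_support:
  fixes f :: "nat \<Rightarrow> real"
  assumes "m < n" "0 \<le> f m" "\<And>k. k < n \<Longrightarrow> k \<noteq> m \<Longrightarrow> f k = 0"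
  shows "Max {f k | k. k < n} = f m"
proof (rule Max_eqI)
  fix y assume "y \<in> {f k | k. k < n}"
  then obtain k where "k < n" "y = f k" by auto
  then show "y \<le> f m" using assms(2,3) by (cases "k = m") auto
qed (use assms(1) in auto)

lemma perm_weight_nonzero_entry:
  assumes "A \<in> carrier_mat n n" "perm_weight A \<sigma> \<noteq> 0" "i < n"
  shows "A $$ (i, \<sigma> i) \<noteq> 0"
  using assms by (auto simp: perm_weight_def)

lemma monomial_part_inverse:
  assumes A: "nonneg_mat n A" and \<sigma>: "\<sigma> permutes {0..<n}" and w: "perm_weight A \<sigma> \<noteq> 0"
  shows "monomial_part A \<sigma> \<otimes>\<^sub>m\<^sub>a\<^sub>x monomial_part_inv A \<sigma> = 1\<^sub>m n"
    and "monomial_part_inv A \<sigma> \<otimes>\<^sub>m\<^sub>a\<^sub>x monomial_part A \<sigma> = 1\<^sub>m n"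
proof -
  have c: "A \<in> carrier_mat n n" and nn: "\<And>i j. i < n \<Longrightarrow> j < n \<Longrightarrow> 0 \<le> A $$ (i, j)"
    using A by (auto simp: nonneg_mat_def)
  have d[simp]: "dim_row A = n" using c by auto
  have lt: "\<sigma> i < n" if "i < n" for i using permutes_in_image[OF \<sigma>, of i] that by auto
  have inj: "\<sigma> i = \<sigma> j \<longleftrightarrow> i = j" for i j using permutes_inj[OF \<sigma>] by (auto dest: injD)
  have nz: "A $$ (i, \<sigma> i) \<noteq> 0" if "i < n" for i
    by (rule perm_weight_nonzero_entry[OF c w that])
  show "monomial_part A \<sigma> \<otimes>\<^sub>m\<^sub>a\<^sub>x monomial_part_inv A \<sigma> = 1\<^sub>m n"
  proof (rule eq_matI)
    fix i j assume "i < dim_row (1\<^sub>m n :: real mat)" "j < dim_col (1\<^sub>m n :: real mat)"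
    then have ij: "i < n" "j < n" by auto
    have "Max {monomial_part A \<sigma> $$ (i, k) * monomial_part_inv A \<sigma> $$ (k, j) | k. k < n}
      = monomial_part A \<sigma> $$ (i, \<sigma> i) * monomial_part_inv A \<sigma> $$ (\<sigma> i, j)"
      using ij lt nn inj by (intro Max_single_support) (auto simp: monomial_part_def monomial_part_inv_def)
    then show "(monomial_part A \<sigma> \<otimes>\<^sub>m\<^sub>a\<^sub>x monomial_part_inv A \<sigma>) $$ (i, j) = 1\<^sub>m n $$ (i, j)"
      using ij lt nz inj by (simp add: max_mult_def monomial_part_def monomial_part_inv_def)
  qed (auto simp: max_mult_def monomial_part_def monomial_part_inv_def)
  show "monomial_part_inv A \<sigma> \<otimes>\<^sub>m\<^sub>a\<^sub>x monomial_part A \<sigma> = 1\<^sub>m n"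
  proof (rule eq_matI)
    fix i j assume "i < dim_row (1\<^sub>m n :: real mat)" "j < dim_col (1\<^sub>m n :: real mat)"
    then have ij: "i < n" "j < n" by auto
    obtain p where p: "p < n" "\<sigma> p = i"
      using permutes_image[OF \<sigma>] ij by (metis atLeastLessThan_iff imageE zero_le)
    have "Max {monomial_part_inv A \<sigma> $$ (i, k) * monomial_part A \<sigma> $$ (k, j) | k. k < n}
      = monomial_part_inv A \<sigma> $$ (i, p) * monomial_part A \<sigma> $$ (p, j)"
      using ij p nn inj by (intro Max_single_support) (auto simp: monomial_part_def monomial_part_inv_def)
    then show "(monomial_part_inv A \<sigma> \<otimes>\<^sub>m\<^sub>a\<^sub>x monomial_part A \<sigma>) $$ (i, j) = 1\<^sub>m n $$ (i, j)"
      using ij p nz by (auto simp: max_mult_def monomial_part_def monomial_part_inv_def)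
  qed (auto simp: max_mult_def monomial_part_def monomial_part_inv_def)
qed

lemma col_normal_entry:
  assumes A: "nonneg_mat n A" and \<sigma>: "\<sigma> permutes {0..<n}" and ij: "i < n" "j < n"
  shows "col_normal A \<sigma> $$ (i, j) = A $$ (i, \<sigma> j) * inverse (A $$ (j, \<sigma> j))"
proof -
  have d[simp]: "dim_row A = n" "dim_col A = n"
    and nn: "\<And>i j. i < n \<Longrightarrow> j < n \<Longrightarrow> 0 \<le> A $$ (i, j)"
    using A by (auto simp: nonneg_mat_def)
  have lt: "\<sigma> j < n" using permutes_in_image[OF \<sigma>, of j] ij by auto
  have "Max {A $$ (i, k) * monomial_part_inv A \<sigma> $$ (k, j) | k. k < n}
    = A $$ (i, \<sigma> j) * monomial_part_inv A \<sigma> $$ (\<sigma> j, j)"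
    using ij lt nn by (intro Max_single_support) (auto simp: monomial_part_inv_def)
  then show ?thesis
    using ij lt by (simp add: col_normal_def max_mult_def monomial_part_inv_def)
qed

lemma row_normal_entry:
  assumes A: "nonneg_mat n A" and \<sigma>: "\<sigma> permutes {0..<n}" and ij: "i < n" "j < n"
  shows "row_normal A \<sigma> $$ (i, j)
    = inverse (A $$ (inv_into UNIV \<sigma> i, i)) * A $$ (inv_into UNIV \<sigma> i, j)"
proof -
  have d[simp]: "dim_row A = n" "dim_col A = n"
    and nn: "\<And>i j. i < n \<Longrightarrow> j < n \<Longrightarrow> 0 \<le> A $$ (i, j)"
    using A by (auto simp: nonneg_mat_def)
  have lt: "inv_into UNIV \<sigma> i < n" using permutes_in_image[OF permutes_inv[OF \<sigma>], of i] ij by auto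
  have iff: "i = \<sigma> k \<longleftrightarrow> k = inv_into UNIV \<sigma> i" for k using permutes_inv_eq[OF \<sigma>, of i k] by auto
  have "Max {monomial_part_inv A \<sigma> $$ (i, k) * A $$ (k, j) | k. k < n}
    = monomial_part_inv A \<sigma> $$ (i, inv_into UNIV \<sigma> i) * A $$ (inv_into UNIV \<sigma> i, j)"
    using ij lt nn iff by (intro Max_single_support) (auto simp: monomial_part_inv_def)
  then show ?thesis
    using ij lt iff by (simp add: row_normal_def max_mult_def monomial_part_inv_def)
qed

end

theory Submission
  imports Defs
begin

text \<open>
  Let \<open>B = A (D\<^sup>\<sigma>)\<^sup>-\<^sup>1\<close>. Since \<open>\<sigma>\<close> has maximal weight, \<open>B\<close> is \<^emph>\<open>normalized\<close>: its diagonal entries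
  are 1 and every permutation has weight at most 1, so that every cycle of the weighted digraph of
  \<open>B\<close> has weight at most 1.

  The entry \<open>(i, j)\<close> of a pseudoadjugate is a maximum over the permutations \<open>\<pi>\<close> of all rows with
  \<open>\<pi> j = i\<close>, the factor of row \<open>j\<close> being left out (\<open>pseudoadj_ge\<close>, \<open>pseudoadj_attained\<close>). The
  remaining arcs \<open>k \<rightarrow> \<pi> k\<close> are a path from \<open>i\<close> to \<open>j\<close> together with disjoint cycles. For a normalized
  matrix the cycles may as well be loops of weight 1, so the pseudoadjugate records the heaviest
  paths. The Kleene star records the heaviest walks, and a walk turns into a path when its cycles,
  of weight at most 1, are cut out. Hence the star of a normalized matrix is its pseudoadjugate
  (\<open>kleene_star_normalized\<close>).

  Writing \<open>\<tau> = \<sigma> \<circ> \<pi>\<close> turns a weight for \<open>B\<close> into a weight for \<open>A\<close>, which shows that the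
  pseudoadjugate of \<open>B\<close> is \<open>D\<^sup>\<sigma> A\<^sup>\<nabla>\<close> (\<open>monomial_mult_pseudoinv\<close>). The second equation of the column
  half says \<open>B \<otimes> B\<^sup>* = B\<^sup>*\<close>, because \<open>A = B D\<^sup>\<sigma>\<close>. The row half is the column half for the transpose of
  \<open>A\<close> and the inverse of \<open>\<sigma>\<close>.
\<close>

section \<open>Entries of products, permanents and pseudoadjugates\<close>

lemma max_mult_carrier [simp]:
  "X \<in> carrier_mat n m \<Longrightarrow> Y \<in> carrier_mat m p \<Longrightarrow> X \<otimes>\<^sub>m\<^sub>a\<^sub>x Y \<in> carrier_mat n p"
  by (auto simp: max_mult_def)

lemma max_mult_entry:
  assumes "X \<in> carrier_mat n n" "Y \<in> carrier_mat n n" "i < n" "j < n"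
  shows "(X \<otimes>\<^sub>m\<^sub>a\<^sub>x Y) $$ (i, j) = Max ((\<lambda>k. X $$ (i, k) * Y $$ (k, j)) ` {0..<n})"
proof -
  have "{X $$ (i, k) * Y $$ (k, j) | k. k < n} = (\<lambda>k. X $$ (i, k) * Y $$ (k, j)) ` {0..<n}"
    by auto
  then show ?thesis using assms by (simp add: max_mult_def)
qed

lemma max_mult_ge:
  assumes "X \<in> carrier_mat n n" "Y \<in> carrier_mat n n" "i < n" "j < n" "k < n"
  shows "X $$ (i, k) * Y $$ (k, j) \<le> (X \<otimes>\<^sub>m\<^sub>a\<^sub>x Y) $$ (i, j)"
  using assms by (simp add: max_mult_entry)

lemma max_mult_attained:
  assumes "X \<in> carrier_mat n n" "Y \<in> carrier_mat n n" "i < n" "j < n"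
  obtains k where "k < n" "(X \<otimes>\<^sub>m\<^sub>a\<^sub>x Y) $$ (i, j) = X $$ (i, k) * Y $$ (k, j)"
proof -
  have "Max ((\<lambda>k. X $$ (i, k) * Y $$ (k, j)) ` {0..<n})
      \<in> (\<lambda>k. X $$ (i, k) * Y $$ (k, j)) ` {0..<n}"
    using assms by (intro Max_in) auto
  then show thesis using that max_mult_entry[OF assms] by auto
qed

lemma max_mult_transpose:
  assumes "X \<in> carrier_mat n n" "Y \<in> carrier_mat n n"
  shows "(X \<otimes>\<^sub>m\<^sub>a\<^sub>x Y)\<^sup>T = Y\<^sup>T \<otimes>\<^sub>m\<^sub>a\<^sub>x X\<^sup>T"
proof (rule eq_matI)
  fix i j assume "i < dim_row (Y\<^sup>T \<otimes>\<^sub>m\<^sub>a\<^sub>x X\<^sup>T)" "j < dim_col (Y\<^sup>T \<otimes>\<^sub>m\<^sub>a\<^sub>x X\<^sup>T)"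
  then have ij: "i < n" "j < n" using assms by (auto simp: max_mult_def)
  have "(Y\<^sup>T \<otimes>\<^sub>m\<^sub>a\<^sub>x X\<^sup>T) $$ (i, j) = Max ((\<lambda>k. Y\<^sup>T $$ (i, k) * X\<^sup>T $$ (k, j)) ` {0..<n})"
    using assms ij by (intro max_mult_entry) auto
  also have "\<dots> = Max ((\<lambda>k. X $$ (j, k) * Y $$ (k, i)) ` {0..<n})"
    using assms ij by (intro arg_cong[where f = Max] image_cong) (auto simp: mult.commute)
  also have "\<dots> = (X \<otimes>\<^sub>m\<^sub>a\<^sub>x Y)\<^sup>T $$ (i, j)"
    using assms ij carrier_matD[OF max_mult_carrier[OF assms]] by (simp add: max_mult_entry)
  finally show "(X \<otimes>\<^sub>m\<^sub>a\<^sub>x Y)\<^sup>T $$ (i, j) = (Y\<^sup>T \<otimes>\<^sub>m\<^sub>a\<^sub>x X\<^sup>T) $$ (i, j)" by simp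
qed (use assms in \<open>auto simp: max_mult_def\<close>)

lemma perm_weight_le_max_per:
  assumes "X \<in> carrier_mat n n" "\<pi> permutes {0..<n}"
  shows "perm_weight X \<pi> \<le> max_per X"
  unfolding max_per_def using assms finite_permutations[of "{0..<n}"]
  by (intro Max_ge) auto

lemma max_per_attained:
  assumes "X \<in> carrier_mat n n"
  obtains \<pi> where "\<pi> permutes {0..<n}" "max_per X = perm_weight X \<pi>"
proof -
  have "max_per X \<in> {perm_weight X \<pi> | \<pi>. \<pi> permutes {0..<dim_row X}}"
    unfolding max_per_def using finite_permutations[of "{0..<dim_row X}"]
    by (intro Max_in) (auto intro: permutes_id)
  then show thesis using that assms by auto
qed

text \<open>Reordering the factors by the permutation: row \<open>k\<close> of one product is row \<open>\<pi> k\<close> of the other.\<close>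

lemma prod_transpose_permutes:
  assumes X: "X \<in> carrier_mat n n" and \<pi>: "\<pi> permutes {0..<n}" and j: "j < n"
  shows "(\<Prod>k\<in>{0..<n} - {\<pi> j}. X\<^sup>T $$ (k, inv_into UNIV \<pi> k)) = (\<Prod>k\<in>{0..<n} - {j}. X $$ (k, \<pi> k))"
proof -
  have lt: "\<pi> k < n \<longleftrightarrow> k < n" for k using permutes_in_image[OF \<pi>, of k] by auto
  have "\<pi> ` ({0..<n} - {j}) = {0..<n} - {\<pi> j}"
    using permutes_image[OF \<pi>] permutes_inj[OF \<pi>] by (simp add: image_set_diff)
  then have "(\<Prod>k\<in>{0..<n} - {\<pi> j}. X\<^sup>T $$ (k, inv_into UNIV \<pi> k))
      = (\<Prod>k\<in>{0..<n} - {j}. X\<^sup>T $$ (\<pi> k, inv_into UNIV \<pi> (\<pi> k)))"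
    using prod.reindex[OF permutes_inj_on[OF \<pi>, of "{0..<n} - {j}"],
        of "\<lambda>k. X\<^sup>T $$ (k, inv_into UNIV \<pi> k)"] by (simp only: o_def)
  also have "\<dots> = (\<Prod>k\<in>{0..<n} - {j}. X $$ (k, \<pi> k))"
    using X by (intro prod.cong) (auto simp: permutes_inverses[OF \<pi>] lt)
  finally show ?thesis .
qed

lemma perm_weight_transpose:
  assumes X: "X \<in> carrier_mat n n" and \<pi>: "\<pi> permutes {0..<n}"
  shows "perm_weight X\<^sup>T (inv_into UNIV \<pi>) = perm_weight X \<pi>"
proof -
  have lt: "\<pi> k < n \<longleftrightarrow> k < n" for k using permutes_in_image[OF \<pi>, of k] by auto
  have "(\<Prod>k\<in>{0..<n}. X\<^sup>T $$ (k, inv_into UNIV \<pi> k)) = (\<Prod>k\<in>{0..<n}. X\<^sup>T $$ (\<pi> k, inv_into UNIV \<pi> (\<pi> k)))"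
    using prod.permute[OF \<pi>] by (simp add: o_def)
  also have "\<dots> = (\<Prod>k\<in>{0..<n}. X $$ (k, \<pi> k))"
    using X by (intro prod.cong) (auto simp: permutes_inverses[OF \<pi>] lt)
  finally show ?thesis using X by (simp add: perm_weight_def)
qed

lemma max_per_transpose:
  assumes X: "X \<in> carrier_mat n n"
  shows "max_per X\<^sup>T = max_per X"
proof -
  have le: "max_per Y \<le> max_per Y\<^sup>T" if Y: "Y \<in> carrier_mat n n" for Y
  proof -
    obtain \<pi> where \<pi>: "\<pi> permutes {0..<n}" "max_per Y = perm_weight Y \<pi>"
      using max_per_attained[OF Y] .
    have "perm_weight Y\<^sup>T (inv_into UNIV \<pi>) \<le> max_per Y\<^sup>T"
      using Y by (intro perm_weight_le_max_per[of _ n] permutes_inv \<pi>(1)) auto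
    then show ?thesis using \<pi> perm_weight_transpose[OF Y \<pi>(1)] by simp
  qed
  show ?thesis using le[OF X] le[of "X\<^sup>T"] X by simp
qed

text \<open>
  A permutation of the \<open>n - 1\<close> rows left in a minor, with the deleted position inserted again, is a
  permutation of all \<open>n\<close> rows with one prescribed value. This removes the index shifts of the
  minors.
\<close>

lemma perm_weight_mat_delete:
  assumes X: "X \<in> carrier_mat (Suc m) (Suc m)" and i: "i < Suc m" and j: "j < Suc m"
    and q: "q permutes {0..<m}"
  shows "perm_weight (mat_delete X j i) q
    = (\<Prod>k\<in>{0..<Suc m} - {j}. X $$ (k, permutation_insert j i q k))"
proof -
  have ins: "permutation_insert j i q (insert_index j k) = insert_index i (q k)" for k
    by (auto simp: permutation_insert_expand insert_index_def)
  have "(\<Prod>k\<in>{0..<Suc m} - {j}. X $$ (k, permutation_insert j i q k))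
      = (\<Prod>k\<in>{0..<m}. X $$ (insert_index j k, insert_index i (q k)))"
    using prod.reindex[OF insert_index_inj_on[of j "{0..<m}"],
        of "\<lambda>k. X $$ (k, permutation_insert j i q k)"]
    by (simp add: insert_index_image[OF j] ins)
  also have "\<dots> = (\<Prod>k\<in>{0..<m}. mat_delete X j i $$ (k, q k))"
    using mat_delete_index[OF X j i] permutes_in_image[OF q] by (intro prod.cong) auto
  finally show ?thesis using X by (simp add: perm_weight_def mat_delete_def)
qed

lemma pseudoadj_carrier [simp]: "X \<in> carrier_mat n n \<Longrightarrow> pseudoadj X \<in> carrier_mat n n"
  by (auto simp: pseudoadj_def)

lemma pseudoadj_ge:
  assumes X: "X \<in> carrier_mat n n" and \<pi>: "\<pi> permutes {0..<n}" and j: "j < n"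
  shows "(\<Prod>k\<in>{0..<n} - {j}. X $$ (k, \<pi> k)) \<le> pseudoadj X $$ (\<pi> j, j)"
proof -
  obtain m where n: "n = Suc m" using j by (cases n) auto
  have i: "\<pi> j < Suc m" using permutes_in_image[OF \<pi>, of j] j n by auto
  obtain q where q: "q permutes {0..<m}" "\<pi> = permutation_insert j (\<pi> j) q"
    using permutation_fix[of j m "\<pi> j"] \<pi> i j unfolding n by blast
  have "perm_weight (mat_delete X j (\<pi> j)) q \<le> max_per (mat_delete X j (\<pi> j))"
    using X n q by (intro perm_weight_le_max_per[of _ m]) (auto simp: mat_delete_def)
  then show ?thesis
    using perm_weight_mat_delete[of X m "\<pi> j" j q] X i j q n by (simp add: pseudoadj_def)
qed

lemma pseudoadj_attained:
  assumes X: "X \<in> carrier_mat n n" and i: "i < n" and j: "j < n"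
  obtains \<pi> where "\<pi> permutes {0..<n}" "\<pi> j = i"
    "pseudoadj X $$ (i, j) = (\<Prod>k\<in>{0..<n} - {j}. X $$ (k, \<pi> k))"
proof -
  obtain m where n: "n = Suc m" using j by (cases n) auto
  have "mat_delete X j i \<in> carrier_mat m m" using X n by (auto simp: mat_delete_def)
  then obtain q where q: "q permutes {0..<m}"
      "max_per (mat_delete X j i) = perm_weight (mat_delete X j i) q"
    using max_per_attained by blast
  let ?\<pi> = "permutation_insert j i q"
  show thesis
  proof (rule that)
    show "?\<pi> permutes {0..<n}" "?\<pi> j = i"
      using permutation_insert_permutes[OF q(1)] i j n by auto
    show "pseudoadj X $$ (i, j) = (\<Prod>k\<in>{0..<n} - {j}. X $$ (k, ?\<pi> k))"
      using perm_weight_mat_delete[of X m i j q] X i j q n by (simp add: pseudoadj_def)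
  qed
qed

lemma pseudoadj_transpose:
  assumes X: "X \<in> carrier_mat n n"
  shows "pseudoadj X\<^sup>T = (pseudoadj X)\<^sup>T"
proof -
  have le: "pseudoadj Y $$ (i, j) \<le> pseudoadj Y\<^sup>T $$ (j, i)"
    if Y: "Y \<in> carrier_mat n n" and i: "i < n" and j: "j < n" for Y i j
  proof -
    obtain \<pi> where \<pi>: "\<pi> permutes {0..<n}" "\<pi> j = i"
        "pseudoadj Y $$ (i, j) = (\<Prod>k\<in>{0..<n} - {j}. Y $$ (k, \<pi> k))"
      using pseudoadj_attained[OF Y i j] .
    have "inv_into UNIV \<pi> i = j" using \<pi> by (metis permutes_inverses(2))
    then show ?thesis
      using pseudoadj_ge[of "Y\<^sup>T" n "inv_into UNIV \<pi>" i] permutes_inv[OF \<pi>(1)] Y i \<pi>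
        prod_transpose_permutes[OF Y \<pi>(1) j] by simp
  qed
  show ?thesis
  proof (rule eq_matI)
    fix i j assume "i < dim_row (pseudoadj X)\<^sup>T" "j < dim_col (pseudoadj X)\<^sup>T"
    then have ij: "i < n" "j < n" using X by (auto simp: pseudoadj_def)
    have "pseudoadj X\<^sup>T $$ (i, j) \<le> pseudoadj X $$ (j, i)" using le[of "X\<^sup>T" i j] X ij by simp
    moreover have "pseudoadj X $$ (j, i) \<le> pseudoadj X\<^sup>T $$ (i, j)" using le[of X j i] X ij by simp
    ultimately show "pseudoadj X\<^sup>T $$ (i, j) = (pseudoadj X)\<^sup>T $$ (i, j)"
      using X ij by (simp add: pseudoadj_def)
  qed (use X in \<open>auto simp: pseudoadj_def\<close>)
qed

section \<open>Simple paths\<close>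

text \<open>
  A path is kept as its vertex set, its first and last vertex and its weight. This is all that
  closing it to a permutation and cutting it at a vertex require.
\<close>

inductive simple_path :: "real mat \<Rightarrow> nat set \<Rightarrow> nat \<Rightarrow> nat \<Rightarrow> real \<Rightarrow> bool" for B where
  start: "simple_path B {i} i i 1"
| step: "simple_path B S i k w \<Longrightarrow> j \<notin> S \<Longrightarrow> simple_path B (insert j S) i j (w * B $$ (k, j))"

lemma simple_path_ends:
  assumes "simple_path B S i j w"
  shows "finite S" "i \<in> S" "j \<in> S"
  using assms by (induction rule: simple_path.induct) auto

lemma simple_path_split:
  assumes "simple_path B S i k w" "j \<in> S"
  shows "\<exists>S1 S2 w1 w2. simple_path B S1 i j w1 \<and> simple_path B S2 j k w2
    \<and> S1 \<subseteq> S \<and> S2 \<subseteq> S \<and> w = w1 * w2"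
  using assms
proof (induction rule: simple_path.induct)
  case (start i)
  then show ?case using simple_path.start[of B i] by force
next
  case (step S i k w l)
  show ?case
  proof (cases "j = l")
    case True
    then show ?thesis
      using simple_path.step[OF step(1,2)] simple_path.start[of B l]
      by (intro exI[of _ "insert l S"] exI[of _ "{l}"] exI[of _ "w * B $$ (k, l)"] exI[of _ 1]) auto
  next
    case False
    then obtain S1 S2 w1 w2 where *: "simple_path B S1 i j w1" "simple_path B S2 j k w2"
        "S1 \<subseteq> S" "S2 \<subseteq> S" "w = w1 * w2"
      using step by auto
    then have "simple_path B (insert l S2) j l (w2 * B $$ (k, l))"
      using step(2) by (intro simple_path.step) auto
    then show ?thesis using *
      by (intro exI[of _ S1] exI[of _ "insert l S2"] exI[of _ w1] exI[of _ "w2 * B $$ (k, l)"]) auto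
  qed
qed

text \<open>
  The arc from the last vertex back to the first closes the path to a cyclic permutation of its
  vertices; the product leaves out that arc.
\<close>

lemma simple_path_permutation:
  assumes "simple_path B S i j w"
  shows "\<exists>\<pi>. \<pi> permutes S \<and> \<pi> j = i \<and> (\<Prod>k\<in>S - {j}. B $$ (k, \<pi> k)) = w"
  using assms
proof (induction rule: simple_path.induct)
  case (start i)
  then show ?case by (intro exI[of _ id]) auto
next
  case (step S i k w j)
  then obtain \<pi> where \<pi>: "\<pi> permutes S" "\<pi> k = i" "(\<Prod>l\<in>S - {k}. B $$ (l, \<pi> l)) = w" by auto
  have k: "k \<in> S" and fin: "finite S" using simple_path_ends[OF step(1)] by auto
  have kj: "k \<noteq> j" and \<pi>j: "\<pi> j = j" using k step(2) permutes_not_in[OF \<pi>(1)] by auto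
  \<comment> \<open>Only the values at \<open>k\<close> and \<open>j\<close> change: \<open>k \<mapsto> j\<close> and \<open>j \<mapsto> i\<close>.\<close>
  let ?\<rho> = "\<pi> \<circ> transpose k j"
  have "?\<rho> permutes insert j S"
    using k by (intro permutes_compose permutes_swap_id permutes_subset[OF \<pi>(1)]) auto
  moreover have "?\<rho> j = i" using \<pi> by simp
  moreover have "(\<Prod>l\<in>insert j S - {j}. B $$ (l, ?\<rho> l)) = w * B $$ (k, j)"
  proof -
    have "insert j S - {j} = S" using step(2) by auto
    then have "(\<Prod>l\<in>insert j S - {j}. B $$ (l, ?\<rho> l))
        = B $$ (k, ?\<rho> k) * (\<Prod>l\<in>S - {k}. B $$ (l, ?\<rho> l))"
      using prod.remove[OF fin k, of "\<lambda>l. B $$ (l, ?\<rho> l)"] by simp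
    also have "(\<Prod>l\<in>S - {k}. B $$ (l, ?\<rho> l)) = (\<Prod>l\<in>S - {k}. B $$ (l, \<pi> l))"
      using step(2) by (intro prod.cong refl) (auto simp: transpose_def)
    finally show ?thesis using \<pi> \<pi>j by simp
  qed
  ultimately show ?case by blast
qed

section \<open>The Kleene star of a normalized matrix\<close>

locale normalized_mat =
  fixes n :: nat and B :: "real mat"
  assumes nonneg: "nonneg_mat n B"
    and diag: "i < n \<Longrightarrow> B $$ (i, i) = 1"
    and weight_le: "\<pi> permutes {0..<n} \<Longrightarrow> perm_weight B \<pi> \<le> 1"
begin

lemma carrier [simp]: "B \<in> carrier_mat n n"
  using nonneg by (simp add: nonneg_mat_def)

lemma dims [simp]: "dim_row B = n" "dim_col B = n"
  using carrier_matD[OF carrier] by auto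

lemma entry_nonneg: "i < n \<Longrightarrow> j < n \<Longrightarrow> 0 \<le> B $$ (i, j)"
  using nonneg by (simp add: nonneg_mat_def)

lemma max_pow_carrier [simp]: "max_pow B m \<in> carrier_mat n n"
  by (induction m) auto

lemma simple_path_nonneg:
  assumes "simple_path B S i j w" "S \<subseteq> {0..<n}"
  shows "0 \<le> w"
  using assms
proof (induction rule: simple_path.induct)
  case (step S i k w j)
  then show ?case using simple_path_ends[OF step(1)] entry_nonneg[of k j] by auto
qed simp

text \<open>Extending a permutation of \<open>S\<close> by loops does not change the product, because loops weigh 1.\<close>

lemma prod_extend:
  assumes "\<pi> permutes S" "S \<subseteq> {0..<n}" "j \<in> S"
  shows "(\<Prod>k\<in>{0..<n} - {j}. B $$ (k, \<pi> k)) = (\<Prod>k\<in>S - {j}. B $$ (k, \<pi> k))"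
proof -
  have "\<forall>k\<in>({0..<n} - {j}) - (S - {j}). B $$ (k, \<pi> k) = 1"
  proof
    fix k assume "k \<in> ({0..<n} - {j}) - (S - {j})"
    then have "k < n" "k \<notin> S" by auto
    then show "B $$ (k, \<pi> k) = 1" using permutes_not_in[OF assms(1)] diag by metis
  qed
  then show ?thesis using assms(2) by (intro prod.mono_neutral_right) auto
qed

lemma simple_path_le_pseudoadj:
  assumes "simple_path B S i j w" "S \<subseteq> {0..<n}"
  shows "w \<le> pseudoadj B $$ (i, j)"
proof -
  obtain \<pi> where \<pi>: "\<pi> permutes S" "\<pi> j = i" "(\<Prod>k\<in>S - {j}. B $$ (k, \<pi> k)) = w"
    using simple_path_permutation[OF assms(1)] by blast
  have j: "j \<in> S" using simple_path_ends[OF assms(1)] by auto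
  show ?thesis
    using pseudoadj_ge[OF carrier permutes_subset[OF \<pi>(1) assms(2)], of j]
      prod_extend[OF \<pi>(1) assms(2) j] \<pi> j assms(2) by auto
qed

lemma perm_weight_split:
  assumes "j < n"
  shows "perm_weight B \<pi> = B $$ (j, \<pi> j) * (\<Prod>k\<in>{0..<n} - {j}. B $$ (k, \<pi> k))"
  using assms prod.remove[of "{0..<n}" j "\<lambda>k. B $$ (k, \<pi> k)"] by (simp add: perm_weight_def)

lemma cycle_le_one:
  assumes "simple_path B S i j w" "S \<subseteq> {0..<n}"
  shows "w * B $$ (j, i) \<le> 1"
proof -
  obtain \<pi> where \<pi>: "\<pi> permutes S" "\<pi> j = i" "(\<Prod>k\<in>S - {j}. B $$ (k, \<pi> k)) = w"
    using simple_path_permutation[OF assms(1)] by blast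
  have j: "j \<in> S" using simple_path_ends[OF assms(1)] by auto
  have "perm_weight B \<pi> \<le> 1" using weight_le permutes_subset[OF \<pi>(1) assms(2)] by blast
  moreover have "perm_weight B \<pi> = B $$ (j, i) * w"
    using perm_weight_split[of j \<pi>] prod_extend[OF \<pi>(1) assms(2) j] \<pi> j assms(2) by auto
  ultimately show ?thesis by (simp add: mult.commute)
qed

text \<open>
  An entry of a power is 0 or the weight of a walk. If the arc added last returns to a vertex of the
  path found so far, it closes a cycle, which may be cut out since it weighs at most 1.
\<close>

lemma max_pow_le_simple_path:
  assumes "i < n" "j < n"
  shows "\<exists>S w. simple_path B S i j w \<and> S \<subseteq> {0..<n} \<and> max_pow B m $$ (i, j) \<le> w"
  using assms(2)
proof (induction m arbitrary: j)
  case 0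
  show ?case
  proof (cases "i = j")
    case True
    then show ?thesis using simple_path.start[of B i] assms
      by (intro exI[of _ "{i}"] exI[of _ 1]) auto
  next
    \<comment> \<open>The entry is 0; any path serves, for instance the single arc.\<close>
    case False
    then have "simple_path B {j, i} i j (1 * B $$ (i, j))"
      by (intro simple_path.step simple_path.start) auto
    then show ?thesis using assms 0 False entry_nonneg[of i j]
      by (intro exI[of _ "{j, i}"] exI[of _ "1 * B $$ (i, j)"]) auto
  qed
next
  case (Suc m)
  obtain k where k: "k < n" and eq: "max_pow B (Suc m) $$ (i, j) = max_pow B m $$ (i, k) * B $$ (k, j)"
    using max_mult_attained[OF max_pow_carrier carrier assms(1) Suc.prems] by (metis max_pow.simps(2))
  obtain S w where S: "simple_path B S i k w" "S \<subseteq> {0..<n}" "max_pow B m $$ (i, k) \<le> w"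
    using Suc.IH[OF k] by blast
  have le: "max_pow B (Suc m) $$ (i, j) \<le> w * B $$ (k, j)"
    using eq mult_right_mono[OF S(3) entry_nonneg[OF k Suc.prems]] by simp
  show ?case
  proof (cases "j \<in> S")
    case False
    then show ?thesis using simple_path.step[OF S(1) False] le S(2) Suc.prems
      by (intro exI[of _ "insert j S"] exI[of _ "w * B $$ (k, j)"]) auto
  next
    case True
    then obtain S1 S2 w1 w2 where sp: "simple_path B S1 i j w1" "simple_path B S2 j k w2"
        "S1 \<subseteq> S" "S2 \<subseteq> S" and w: "w = w1 * w2"
      using simple_path_split[OF S(1)] by blast
    have "w2 * B $$ (k, j) \<le> 1" using cycle_le_one[OF sp(2)] sp(4) S(2) by auto
    moreover have "0 \<le> w1" using simple_path_nonneg[OF sp(1)] sp(3) S(2) by auto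
    ultimately have "w1 * (w2 * B $$ (k, j)) \<le> w1" using mult_left_mono by fastforce
    then show ?thesis using le w sp S(2)
      by (intro exI[of _ S1] exI[of _ w1]) (auto simp: mult.assoc)
  qed
qed

lemma max_pow_le_pseudoadj:
  assumes "i < n" "j < n"
  shows "max_pow B m $$ (i, j) \<le> pseudoadj B $$ (i, j)"
  using max_pow_le_simple_path[OF assms, of m] simple_path_le_pseudoadj by fastforce

text \<open>
  Peeling the last arc \<open>l \<rightarrow> j\<close> off the path turns \<open>j\<close> into a fixed point and leaves a permutation
  that closes the path ending at \<open>l\<close>. When the path is used up, the rest is a product of cycles and
  weighs at most 1.
\<close>

lemma prod_le_max_pow:
  assumes "\<pi> permutes {0..<n}" "\<pi> j = i" "i < n" "j < n"
  shows "\<exists>m. (\<Prod>k\<in>{0..<n} - {j}. B $$ (k, \<pi> k)) \<le> max_pow B m $$ (i, j)"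
  using assms
proof (induction "card {k \<in> {0..<n}. \<pi> k \<noteq> k}" arbitrary: \<pi> j rule: less_induct)
  case less
  show ?case
  proof (cases "i = j")
    case True
    have "(\<Prod>k\<in>{0..<n} - {j}. B $$ (k, \<pi> k)) \<le> 1"
      using weight_le[OF less.prems(1)] perm_weight_split[OF less.prems(4), of \<pi>] diag less.prems True
      by simp
    then show ?thesis using True less.prems by (intro exI[of _ 0]) auto
  next
    case False
    define l where "l = inv_into UNIV \<pi> j"
    have l: "\<pi> l = j" "l < n"
      using permutes_inverses[OF less.prems(1)] permutes_in_image[OF permutes_inv[OF less.prems(1)], of j]
        less.prems by (auto simp: l_def)
    have lj: "l \<noteq> j" using l False less.prems by auto
    let ?\<rho> = "\<pi> \<circ> transpose j l"
    have \<rho>: "?\<rho> permutes {0..<n}"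
      using less.prems l by (intro permutes_compose permutes_swap_id) auto
    have \<rho>v: "?\<rho> j = j" "?\<rho> l = i" and \<rho>o: "\<And>k. k \<noteq> j \<Longrightarrow> k \<noteq> l \<Longrightarrow> ?\<rho> k = \<pi> k"
      using l less.prems by (auto simp: transpose_def)
    have "{k \<in> {0..<n}. ?\<rho> k \<noteq> k} \<subset> {k \<in> {0..<n}. \<pi> k \<noteq> k}"
    proof
      show "{k \<in> {0..<n}. ?\<rho> k \<noteq> k} \<subseteq> {k \<in> {0..<n}. \<pi> k \<noteq> k}"
      proof
        fix k assume k: "k \<in> {k \<in> {0..<n}. ?\<rho> k \<noteq> k}"
        then have "k \<noteq> j" using \<rho>v by auto
        then show "k \<in> {k \<in> {0..<n}. \<pi> k \<noteq> k}" using k \<rho>o[of k] l lj by (cases "k = l") auto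
      qed
      show "{k \<in> {0..<n}. ?\<rho> k \<noteq> k} \<noteq> {k \<in> {0..<n}. \<pi> k \<noteq> k}"
      proof
        assume eq: "{k \<in> {0..<n}. ?\<rho> k \<noteq> k} = {k \<in> {0..<n}. \<pi> k \<noteq> k}"
        have "j \<in> {k \<in> {0..<n}. \<pi> k \<noteq> k}" using less.prems False by simp
        then have "j \<in> {k \<in> {0..<n}. ?\<rho> k \<noteq> k}" by (simp only: eq)
        then show False using \<rho>v(1) by simp
      qed
    qed
    then have "card {k \<in> {0..<n}. ?\<rho> k \<noteq> k} < card {k \<in> {0..<n}. \<pi> k \<noteq> k}"
      by (intro psubset_card_mono) auto
    from less.hyps[OF this \<rho> \<rho>v(2) less.prems(3) l(2)]
    obtain m where m: "(\<Prod>k\<in>{0..<n} - {l}. B $$ (k, ?\<rho> k)) \<le> max_pow B m $$ (i, l)" by blast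
    let ?R = "\<Prod>k\<in>{0..<n} - {j} - {l}. B $$ (k, \<pi> k)"
    have "(\<Prod>k\<in>{0..<n} - {l}. B $$ (k, ?\<rho> k))
        = B $$ (j, ?\<rho> j) * (\<Prod>k\<in>{0..<n} - {l} - {j}. B $$ (k, ?\<rho> k))"
      using lj less.prems by (intro prod.remove) auto
    also have "(\<Prod>k\<in>{0..<n} - {l} - {j}. B $$ (k, ?\<rho> k)) = ?R"
      using \<rho>o by (intro prod.cong) auto
    finally have R: "(\<Prod>k\<in>{0..<n} - {l}. B $$ (k, ?\<rho> k)) = ?R"
      using \<rho>v(1) diag less.prems by simp
    have "(\<Prod>k\<in>{0..<n} - {j}. B $$ (k, \<pi> k)) = B $$ (l, \<pi> l) * ?R"
      using lj l by (intro prod.remove) auto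
    also have "\<dots> \<le> max_pow B m $$ (i, l) * B $$ (l, j)"
      using mult_right_mono[OF m[unfolded R] entry_nonneg[OF l(2) less.prems(4)]] l
      by (simp add: mult.commute)
    also have "\<dots> \<le> max_pow B (Suc m) $$ (i, j)"
      using max_mult_ge[OF max_pow_carrier carrier less.prems(3,4) l(2)] by simp
    finally show ?thesis by blast
  qed
qed

lemma pseudoadj_le_max_pow:
  assumes "i < n" "j < n"
  obtains m where "pseudoadj B $$ (i, j) \<le> max_pow B m $$ (i, j)"
proof -
  obtain \<pi> where \<pi>: "\<pi> permutes {0..<n}" "\<pi> j = i"
      "pseudoadj B $$ (i, j) = (\<Prod>k\<in>{0..<n} - {j}. B $$ (k, \<pi> k))"
    using pseudoadj_attained[OF carrier assms] .
  show thesis using prod_le_max_pow[OF \<pi>(1,2) assms] that \<pi>(3) by auto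
qed

theorem kleene_star_normalized: "kleene_star B = ennmat (pseudoadj B)"
proof (rule eq_matI)
  fix i j assume "i < dim_row (ennmat (pseudoadj B))" "j < dim_col (ennmat (pseudoadj B))"
  then have ij: "i < n" "j < n" by (auto simp: ennmat_def pseudoadj_def)
  have "(SUP k. ennreal (max_pow B k $$ (i, j))) = ennreal (pseudoadj B $$ (i, j))"
  proof (rule antisym)
    show "(SUP k. ennreal (max_pow B k $$ (i, j))) \<le> ennreal (pseudoadj B $$ (i, j))"
      by (intro SUP_least ennreal_leI max_pow_le_pseudoadj ij)
    obtain m where "pseudoadj B $$ (i, j) \<le> max_pow B m $$ (i, j)"
      using pseudoadj_le_max_pow[OF ij] .
    then show "ennreal (pseudoadj B $$ (i, j)) \<le> (SUP k. ennreal (max_pow B k $$ (i, j)))"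
      by (intro SUP_upper2[of m] ennreal_leI) auto
  qed
  then show "kleene_star B $$ (i, j) = ennmat (pseudoadj B) $$ (i, j)"
    using ij carrier_matD[OF pseudoadj_carrier[OF carrier]] by (simp add: kleene_star_def ennmat_def)
qed (auto simp: kleene_star_def ennmat_def pseudoadj_def)

lemma pseudoadj_mult_le:
  assumes "i < n" "j < n" "k < n"
  shows "pseudoadj B $$ (i, k) * B $$ (k, j) \<le> pseudoadj B $$ (i, j)"
proof -
  obtain m where m: "pseudoadj B $$ (i, k) \<le> max_pow B m $$ (i, k)"
    using pseudoadj_le_max_pow[OF assms(1,3)] .
  have "pseudoadj B $$ (i, k) * B $$ (k, j) \<le> max_pow B m $$ (i, k) * B $$ (k, j)"
    using m entry_nonneg assms by (intro mult_right_mono) auto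
  also have "\<dots> \<le> max_pow B (Suc m) $$ (i, j)"
    using max_mult_ge[OF max_pow_carrier carrier assms] by simp
  also have "\<dots> \<le> pseudoadj B $$ (i, j)" by (rule max_pow_le_pseudoadj[OF assms(1,2)])
  finally show ?thesis .
qed

lemma normalized_transpose: "normalized_mat n B\<^sup>T"
proof
  show "nonneg_mat n B\<^sup>T" using entry_nonneg by (simp add: nonneg_mat_def)
  show "B\<^sup>T $$ (i, i) = 1" if "i < n" for i using that diag by simp
  show "perm_weight B\<^sup>T \<pi> \<le> 1" if \<pi>: "\<pi> permutes {0..<n}" for \<pi>
    using perm_weight_transpose[OF carrier permutes_inv[OF \<pi>]] weight_le[OF permutes_inv[OF \<pi>]]
      permutes_inv_inv[OF \<pi>] by simp
qed

text \<open>The powers multiply on the right, so the left-hand version comes from the transpose.\<close>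

lemma mult_pseudoadj_le:
  assumes "i < n" "j < n" "k < n"
  shows "B $$ (i, k) * pseudoadj B $$ (k, j) \<le> pseudoadj B $$ (i, j)"
  using normalized_mat.pseudoadj_mult_le[OF normalized_transpose, of j i k] assms
    pseudoadj_transpose[OF carrier] carrier_matD[OF pseudoadj_carrier[OF carrier]]
  by (simp add: mult.commute)

end

section \<open>The column normal form\<close>

locale maximal_weight_perm =
  fixes n :: nat and A :: "real mat" and \<sigma> :: "nat \<Rightarrow> nat"
  assumes nonneg: "nonneg_mat n A"
    and per_nonzero: "max_per A \<noteq> 0"
    and perm: "\<sigma> permutes {0..<n}"
    and maximal: "perm_weight A \<sigma> = max_per A"
begin

lemma carrier [simp]: "A \<in> carrier_mat n n"
  using nonneg by (simp add: nonneg_mat_def)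

lemma dims [simp]: "dim_row A = n" "dim_col A = n"
  using carrier_matD[OF carrier] by auto

lemma entry_nonneg: "i < n \<Longrightarrow> j < n \<Longrightarrow> 0 \<le> A $$ (i, j)"
  using nonneg by (simp add: nonneg_mat_def)

lemma perm_lt [simp]: "\<sigma> i < n \<longleftrightarrow> i < n"
  using permutes_in_image[OF perm, of i] by auto

lemma selected_pos: "i < n \<Longrightarrow> 0 < A $$ (i, \<sigma> i)"
  using perm_weight_nonzero_entry[OF carrier, of \<sigma> i] maximal per_nonzero entry_nonneg[of i "\<sigma> i"]
  by (metis order_le_imp_less_or_eq perm_lt)

lemma per_eq: "max_per A = (\<Prod>k\<in>{0..<n}. A $$ (k, \<sigma> k))"
  using maximal by (simp add: perm_weight_def)

lemma per_pos: "0 < max_per A"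
  unfolding per_eq using selected_pos by (intro prod_pos) auto

lemma pseudoinv_carrier [simp]: "pseudoinv A \<in> carrier_mat n n"
  by (simp add: pseudoinv_def)

lemma monomial_part_carrier [simp]: "monomial_part A \<sigma> \<in> carrier_mat n n"
  by (simp add: monomial_part_def)

lemma col_normal_carrier [simp]: "col_normal A \<sigma> \<in> carrier_mat n n"
  by (auto simp: col_normal_def monomial_part_inv_def max_mult_def)

lemma col_normal_dims [simp]: "dim_row (col_normal A \<sigma>) = n" "dim_col (col_normal A \<sigma>) = n"
  using carrier_matD[OF col_normal_carrier] by auto

lemma part_dims [simp]:
  "dim_row (pseudoinv A) = n" "dim_col (pseudoinv A) = n"
  "dim_row (monomial_part A \<sigma>) = n" "dim_col (monomial_part A \<sigma>) = n"
  using carrier_matD[OF pseudoinv_carrier] carrier_matD[OF monomial_part_carrier] by auto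

lemma prod_permute_selected:
  assumes \<pi>: "\<pi> permutes {0..<n}"
  shows "(\<Prod>k\<in>{0..<n}. A $$ (\<pi> k, \<sigma> (\<pi> k))) = max_per A"
  using prod.permute[OF \<pi>, of "\<lambda>k. A $$ (k, \<sigma> k)"] by (simp add: per_eq o_def)

lemma col_normal_normalized: "normalized_mat n (col_normal A \<sigma>)"
proof
  show "nonneg_mat n (col_normal A \<sigma>)"
    using col_normal_entry[OF nonneg perm] entry_nonneg by (auto simp: nonneg_mat_def)
  show "col_normal A \<sigma> $$ (i, i) = 1" if "i < n" for i
    using col_normal_entry[OF nonneg perm that that] selected_pos[OF that] by simp
  fix \<pi> assume \<pi>: "\<pi> permutes {0..<n}"
  have lt: "\<pi> k < n \<longleftrightarrow> k < n" for k using permutes_in_image[OF \<pi>, of k] by auto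
  have "perm_weight (col_normal A \<sigma>) \<pi>
      = (\<Prod>k\<in>{0..<n}. A $$ (k, \<sigma> (\<pi> k)) / A $$ (\<pi> k, \<sigma> (\<pi> k)))"
    using col_normal_entry[OF nonneg perm] unfolding perm_weight_def
    by (intro prod.cong) (auto simp: lt divide_inverse)
  also have "\<dots> = perm_weight A (\<sigma> \<circ> \<pi>) / max_per A"
    using prod_permute_selected[OF \<pi>] by (simp add: prod_dividef perm_weight_def)
  also have "\<dots> \<le> 1"
    using perm_weight_le_max_per[OF carrier permutes_compose[OF \<pi> perm]] per_pos by simp
  finally show "perm_weight (col_normal A \<sigma>) \<pi> \<le> 1" .
qed

text \<open>
  The denominators \<open>a\<^bsub>\<pi> k, \<sigma> (\<pi> k)\<^esub>\<close> with \<open>k \<noteq> j\<close> run over all selected entries of \<open>A\<close> but the one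
  in row \<open>\<pi> j\<close>, so their product is \<open>per A\<close> divided by that entry.
\<close>

lemma prod_col_normal:
  assumes \<pi>: "\<pi> permutes {0..<n}" and j: "j < n"
  shows "(\<Prod>k\<in>{0..<n} - {j}. col_normal A \<sigma> $$ (k, \<pi> k))
    = A $$ (\<pi> j, \<sigma> (\<pi> j)) * inverse (max_per A) * (\<Prod>k\<in>{0..<n} - {j}. A $$ (k, (\<sigma> \<circ> \<pi>) k))"
proof -
  have lt: "\<pi> k < n \<longleftrightarrow> k < n" for k using permutes_in_image[OF \<pi>, of k] by auto
  let ?Q = "\<Prod>k\<in>{0..<n} - {j}. A $$ (\<pi> k, \<sigma> (\<pi> k))"
  have Q: "max_per A = A $$ (\<pi> j, \<sigma> (\<pi> j)) * ?Q"
    using prod_permute_selected[OF \<pi>] prod.remove[of "{0..<n}" j "\<lambda>k. A $$ (\<pi> k, \<sigma> (\<pi> k))"] j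
    by simp
  have "(\<Prod>k\<in>{0..<n} - {j}. col_normal A \<sigma> $$ (k, \<pi> k))
      = (\<Prod>k\<in>{0..<n} - {j}. A $$ (k, (\<sigma> \<circ> \<pi>) k) / A $$ (\<pi> k, \<sigma> (\<pi> k)))"
    using col_normal_entry[OF nonneg perm] by (intro prod.cong) (auto simp: lt divide_inverse)
  also have "\<dots> = (\<Prod>k\<in>{0..<n} - {j}. A $$ (k, (\<sigma> \<circ> \<pi>) k)) / ?Q"
    by (simp add: prod_dividef)
  finally show ?thesis
    using Q per_nonzero by (simp add: field_simps)
qed

lemma pseudoadj_col_normal:
  assumes i: "i < n" and j: "j < n"
  shows "pseudoadj (col_normal A \<sigma>) $$ (i, j) = A $$ (i, \<sigma> i) * pseudoinv A $$ (\<sigma> i, j)"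
proof (rule antisym)
  have pinv: "A $$ (i, \<sigma> i) * pseudoinv A $$ (\<sigma> i, j)
      = A $$ (i, \<sigma> i) * inverse (max_per A) * pseudoadj A $$ (\<sigma> i, j)"
    using i j carrier_matD[OF pseudoadj_carrier[OF carrier]] by (simp add: pseudoinv_def)
  have scale: "0 \<le> A $$ (i, \<sigma> i) * inverse (max_per A)"
    using selected_pos[OF i] per_pos by simp
  show "pseudoadj (col_normal A \<sigma>) $$ (i, j) \<le> A $$ (i, \<sigma> i) * pseudoinv A $$ (\<sigma> i, j)"
  proof -
    obtain \<pi> where \<pi>: "\<pi> permutes {0..<n}" "\<pi> j = i" "pseudoadj (col_normal A \<sigma>) $$ (i, j)
        = (\<Prod>k\<in>{0..<n} - {j}. col_normal A \<sigma> $$ (k, \<pi> k))"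
      using pseudoadj_attained[OF col_normal_carrier i j] .
    have "(\<Prod>k\<in>{0..<n} - {j}. A $$ (k, (\<sigma> \<circ> \<pi>) k)) \<le> pseudoadj A $$ (\<sigma> i, j)"
      using pseudoadj_ge[OF carrier permutes_compose[OF \<pi>(1) perm] j] \<pi>(2) by simp
    from mult_left_mono[OF this scale] show ?thesis
      unfolding \<pi>(3) prod_col_normal[OF \<pi>(1) j] pinv unfolding \<pi>(2) .
  qed
  show "A $$ (i, \<sigma> i) * pseudoinv A $$ (\<sigma> i, j) \<le> pseudoadj (col_normal A \<sigma>) $$ (i, j)"
  proof -
    have si: "\<sigma> i < n" using i by simp
    obtain \<tau> where \<tau>: "\<tau> permutes {0..<n}" "\<tau> j = \<sigma> i"
        "pseudoadj A $$ (\<sigma> i, j) = (\<Prod>k\<in>{0..<n} - {j}. A $$ (k, \<tau> k))"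
      using pseudoadj_attained[OF carrier si j] .
    let ?\<pi> = "inv_into UNIV \<sigma> \<circ> \<tau>"
    have \<pi>: "?\<pi> permutes {0..<n}" by (rule permutes_compose[OF \<tau>(1) permutes_inv[OF perm]])
    have \<pi>j: "?\<pi> j = i" and \<sigma>\<pi>: "\<sigma> \<circ> ?\<pi> = \<tau>"
      using \<tau>(2) by (auto simp: fun_eq_iff permutes_inverses[OF perm])
    show ?thesis
      using pseudoadj_ge[OF col_normal_carrier \<pi> j] prod_col_normal[OF \<pi> j]
      unfolding \<sigma>\<pi> \<pi>j pinv \<tau>(3) by (simp only:)
  qed
qed

lemma monomial_mult_pseudoinv:
  "monomial_part A \<sigma> \<otimes>\<^sub>m\<^sub>a\<^sub>x pseudoinv A = pseudoadj (col_normal A \<sigma>)"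
proof (rule eq_matI)
  fix i j
  assume "i < dim_row (pseudoadj (col_normal A \<sigma>))" "j < dim_col (pseudoadj (col_normal A \<sigma>))"
  then have ij: "i < n" "j < n" by (auto simp: pseudoadj_def)
  have "0 \<le> pseudoadj (col_normal A \<sigma>) $$ (i, j)"
  proof -
    obtain \<pi> where \<pi>: "\<pi> permutes {0..<n}" "pseudoadj (col_normal A \<sigma>) $$ (i, j)
        = (\<Prod>k\<in>{0..<n} - {j}. col_normal A \<sigma> $$ (k, \<pi> k))"
      using pseudoadj_attained[OF col_normal_carrier ij] by metis
    then show ?thesis
      using normalized_mat.entry_nonneg[OF col_normal_normalized] permutes_in_image[OF \<pi>(1)]
      by (auto intro!: prod_nonneg)
  qed
  then have "Max {monomial_part A \<sigma> $$ (i, k) * pseudoinv A $$ (k, j) | k. k < n}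
      = monomial_part A \<sigma> $$ (i, \<sigma> i) * pseudoinv A $$ (\<sigma> i, j)"
    using ij pseudoadj_col_normal[OF ij] by (intro Max_single_support) (auto simp: monomial_part_def)
  then show "(monomial_part A \<sigma> \<otimes>\<^sub>m\<^sub>a\<^sub>x pseudoinv A) $$ (i, j) = pseudoadj (col_normal A \<sigma>) $$ (i, j)"
    using ij pseudoadj_col_normal[OF ij] by (simp add: max_mult_def monomial_part_def)
qed (auto simp: max_mult_def pseudoadj_def)

lemma mult_pseudoinv: "A \<otimes>\<^sub>m\<^sub>a\<^sub>x pseudoinv A = pseudoadj (col_normal A \<sigma>)"
proof (rule eq_matI)
  fix i j
  assume "i < dim_row (pseudoadj (col_normal A \<sigma>))" "j < dim_col (pseudoadj (col_normal A \<sigma>))"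
  then have ij: "i < n" "j < n" by (auto simp: pseudoadj_def)
  let ?B = "col_normal A \<sigma>"
  \<comment> \<open>The index \<open>\<sigma> l\<close> of the product is the index \<open>l\<close> of \<open>B \<otimes> B\<^sup>*\<close>, since \<open>A = B D\<^sup>\<sigma>\<close>.\<close>
  have factor: "A $$ (i, \<sigma> l) * pseudoinv A $$ (\<sigma> l, j) = ?B $$ (i, l) * pseudoadj ?B $$ (l, j)"
    if l: "l < n" for l
    using col_normal_entry[OF nonneg perm ij(1) l] pseudoadj_col_normal[OF l ij(2)] selected_pos[OF l]
    by simp
  show "(A \<otimes>\<^sub>m\<^sub>a\<^sub>x pseudoinv A) $$ (i, j) = pseudoadj ?B $$ (i, j)"
  proof (rule antisym)
    obtain k where k: "k < n"
        "(A \<otimes>\<^sub>m\<^sub>a\<^sub>x pseudoinv A) $$ (i, j) = A $$ (i, k) * pseudoinv A $$ (k, j)"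
      using max_mult_attained[OF carrier pseudoinv_carrier ij] .
    define l where "l = inv_into UNIV \<sigma> k"
    have l: "\<sigma> l = k" by (simp add: l_def permutes_inverses[OF perm])
    then have "l < n" using k(1) perm_lt by metis
    then show "(A \<otimes>\<^sub>m\<^sub>a\<^sub>x pseudoinv A) $$ (i, j) \<le> pseudoadj ?B $$ (i, j)"
      using k(2) factor[of l] normalized_mat.mult_pseudoadj_le[OF col_normal_normalized ij, of l] l
      by simp
    show "pseudoadj ?B $$ (i, j) \<le> (A \<otimes>\<^sub>m\<^sub>a\<^sub>x pseudoinv A) $$ (i, j)"
      using max_mult_ge[OF carrier pseudoinv_carrier ij, of "\<sigma> i"] ij pseudoadj_col_normal[OF ij]
      by simp
  qed
qed (auto simp: max_mult_def pseudoadj_def)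

section \<open>Transposition\<close>

lemma maximal_weight_perm_transpose: "maximal_weight_perm n A\<^sup>T (inv_into UNIV \<sigma>)"
proof
  show "nonneg_mat n A\<^sup>T" using entry_nonneg by (simp add: nonneg_mat_def)
  show "max_per A\<^sup>T \<noteq> 0" using per_nonzero max_per_transpose[OF carrier] by simp
  show "inv_into UNIV \<sigma> permutes {0..<n}" by (rule permutes_inv[OF perm])
  show "perm_weight A\<^sup>T (inv_into UNIV \<sigma>) = max_per A\<^sup>T"
    using perm_weight_transpose[OF carrier perm] max_per_transpose[OF carrier] maximal by simp
qed

lemma row_normal_transpose: "row_normal A \<sigma> = (col_normal A\<^sup>T (inv_into UNIV \<sigma>))\<^sup>T"
proof -
  interpret T: maximal_weight_perm n "A\<^sup>T" "inv_into UNIV \<sigma>" by (rule maximal_weight_perm_transpose)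
  show ?thesis
  proof (rule eq_matI)
    fix i j
    assume "i < dim_row (col_normal A\<^sup>T (inv_into UNIV \<sigma>))\<^sup>T" "j < dim_col (col_normal A\<^sup>T (inv_into UNIV \<sigma>))\<^sup>T"
    then have ij: "i < n" "j < n" by auto
    then show "row_normal A \<sigma> $$ (i, j) = (col_normal A\<^sup>T (inv_into UNIV \<sigma>))\<^sup>T $$ (i, j)"
      using row_normal_entry[OF nonneg perm ij] col_normal_entry[OF T.nonneg T.perm ij(2,1)]
        T.perm_lt[of i] by (simp add: mult.commute)
  qed (auto simp: row_normal_def max_mult_def monomial_part_inv_def)
qed

lemma pseudoinv_transpose: "pseudoinv A\<^sup>T = (pseudoinv A)\<^sup>T"
  unfolding pseudoinv_def pseudoadj_transpose[OF carrier] max_per_transpose[OF carrier]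
  by (rule eq_matI) auto

lemma monomial_part_transpose: "monomial_part A\<^sup>T (inv_into UNIV \<sigma>) = (monomial_part A \<sigma>)\<^sup>T"
proof (rule eq_matI)
  fix i j assume "i < dim_row (monomial_part A \<sigma>)\<^sup>T" "j < dim_col (monomial_part A \<sigma>)\<^sup>T"
  then have "i < n" "j < n" by (auto simp: monomial_part_def)
  moreover have "j = inv_into UNIV \<sigma> i \<longleftrightarrow> i = \<sigma> j" using permutes_inv_eq[OF perm, of i j] by auto
  ultimately show "monomial_part A\<^sup>T (inv_into UNIV \<sigma>) $$ (i, j) = (monomial_part A \<sigma>)\<^sup>T $$ (i, j)"
    by (simp add: monomial_part_def)
qed (auto simp: monomial_part_def)

end

section \<open>Kleene stars and the pseudoinverse\<close>

theorem theorem3p20: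
  fixes A :: "real mat" and n :: nat and \<sigma> :: "nat \<Rightarrow> nat"
  assumes "nonneg_mat n A"
    and "max_per A \<noteq> 0"
    and "\<sigma> permutes {0..<n}"
    and "perm_weight A \<sigma> = max_per A"
  shows "(kleene_star (col_normal A \<sigma>) = ennmat (monomial_part A \<sigma> \<otimes>\<^sub>m\<^sub>a\<^sub>x pseudoinv A)
        \<and> monomial_part A \<sigma> \<otimes>\<^sub>m\<^sub>a\<^sub>x pseudoinv A = A \<otimes>\<^sub>m\<^sub>a\<^sub>x pseudoinv A)
      \<and> (kleene_star (row_normal A \<sigma>) = ennmat (pseudoinv A \<otimes>\<^sub>m\<^sub>a\<^sub>x monomial_part A \<sigma>)
        \<and> pseudoinv A \<otimes>\<^sub>m\<^sub>a\<^sub>x monomial_part A \<sigma> = pseudoinv A \<otimes>\<^sub>m\<^sub>a\<^sub>x A)"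
proof -
  interpret maximal_weight_perm n A \<sigma> using assms by unfold_locales
  interpret T: maximal_weight_perm n "A\<^sup>T" "inv_into UNIV \<sigma>" by (rule maximal_weight_perm_transpose)
  let ?C = "col_normal A\<^sup>T (inv_into UNIV \<sigma>)"
  have col: "kleene_star (col_normal A \<sigma>) = ennmat (pseudoadj (col_normal A \<sigma>))"
    by (rule normalized_mat.kleene_star_normalized[OF col_normal_normalized])
  have "kleene_star (row_normal A \<sigma>) = ennmat (pseudoadj (row_normal A \<sigma>))"
    unfolding row_normal_transpose
    by (rule normalized_mat.kleene_star_normalized[OF
          normalized_mat.normalized_transpose[OF T.col_normal_normalized]])
  also have "pseudoadj (row_normal A \<sigma>) = (pseudoadj ?C)\<^sup>T"
    unfolding row_normal_transpose by (rule pseudoadj_transpose[OF T.col_normal_carrier])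
  finally have row: "kleene_star (row_normal A \<sigma>) = ennmat ((pseudoadj ?C)\<^sup>T)" .
  have right_monomial: "(pseudoadj ?C)\<^sup>T = pseudoinv A \<otimes>\<^sub>m\<^sub>a\<^sub>x monomial_part A \<sigma>"
    using max_mult_transpose[OF T.monomial_part_carrier T.pseudoinv_carrier]
    unfolding T.monomial_mult_pseudoinv
    by (simp only: pseudoinv_transpose monomial_part_transpose transpose_transpose)
  have right_mult: "(pseudoadj ?C)\<^sup>T = pseudoinv A \<otimes>\<^sub>m\<^sub>a\<^sub>x A"
    using max_mult_transpose[OF T.carrier T.pseudoinv_carrier]
    unfolding T.mult_pseudoinv
    by (simp only: pseudoinv_transpose transpose_transpose)
  show ?thesis
    unfolding monomial_mult_pseudoinv mult_pseudoinv
      right_monomial[symmetric] right_mult[symmetric]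
    using col row by blast
qed

end
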